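(* Let $(\Omega,R_\ast)$ be a polycrystal. Suppose that the values attained by $R_\ast$ on the grains of $(\Omega,R_\ast)$ are $$R_{\theta_1},\ldots,R_{\theta_N}\quad\text{with } 0=\theta_1<\theta_2<\ldots<\theta_N<\pi,\quad N\geq 2,$$ and let $\theta_{N+1}=\pi$. Then $$\mathcal T_{\mathcal N}(R_\ast(\Omega))=\mathcal N\cap \mathcal N R_{\theta_n}^T\cap \mathcal N R_{\theta_{n+1}}^T,$$ where $n\in\{1,\ldots,N\}$ is uniquely determined by the relation $\theta_n<\frac{\pi}{2}\leq \theta_{n+1}$.
   Context: Notation: $e_1,e_2$ is the standard basis of $\mathbb R^2$, $|\cdot|$ the Euclidean norm, $R_\theta=\begin{pmatrix}\cos\theta&-\sin\theta\\ \sin\theta&\cos\theta\end{pmatrix}\in \mathrm{SO}(2)$, and $$\mathcal N:=\{F\in\mathbb R^{2\times 2}:\det F=1,\ |Fe_1|\leq 1\}.$$ For $R\in\mathrm{SO}(2)$, $\mathcal N R^T=\{FR^T: F\in\mathcal N\}=\{F:\det F=1,\ |FRe_1|\le 1\}$. Polycrystal: a pair $(\Omega,R_\ast)$ such that $\Omega\subset\mathbb R^2$ is a bounded Lipschitz domain with a partition (up to a set of measure zero) into finitely many bounded Lipschitz domains $\Omega_1,\ldots,\Omega_K\subset\Omega$ (the grains), i.e. $\Omega=\mathrm{int}\bigcup_{k=1}^K\overline{\Omega}_k$ and $\mathrm{int}\,\overline{\Omega}_k=\Omega_k$ for all $k$; and $R_\ast:\Omega\to\mathrm{SO}(2)$ is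 constant on each $\Omega_k$, with $R_\ast|_{\Omega_k}\neq\pm R_\ast|_{\Omega_l}$ whenever $k\neq l$ and $\mathcal H^1(\partial\Omega_k\cap\partial\Omega_l)>0$ ($\mathcal H^1$ the one-dimensional Hausdorff measure). $R_\ast(\Omega)$ denotes the (finite) image of $R_\ast$; only values on the grains are taken into account. Taylor bound: $\mathcal T_{\mathcal N}(R_\ast(\Omega)):=\bigcap_{x\in\Omega}\mathcal N R_\ast^T(x)$, the finite intersection of the sets $\mathcal N R^T$ over all values $R$ attained by $R_\ast$ on the grains. *)

theory Defs
  imports "HOL-Analysis.Analysis"
begin

definition rot :: "real \<Rightarrow> real^2^2" where
  "rot \<theta> = vector [vector [cos \<theta>, - sin \<theta>], vector [sin \<theta>, cos \<theta>]]"

text \<open>Near every boundary point, in suitable orthonormal coordinates, \<open>\<Omega>\<close> is the open region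
  above the graph of a Lipschitz function. As \<open>Q\<close> is linear, the position of the
  boundary point is absorbed in \<open>\<gamma>\<close>.\<close>

definition lipschitz_boundary :: "(real^2) set \<Rightarrow> bool" where
  "lipschitz_boundary \<Omega> \<longleftrightarrow>
     (\<forall>x0\<in>frontier \<Omega>. \<exists>r>0. \<exists>Q :: real^2 \<Rightarrow> real^2. \<exists>L. \<exists>\<gamma> :: real \<Rightarrow> real.
        orthogonal_transformation Q \<and> L-lipschitz_on UNIV \<gamma> \<and>
        \<Omega> \<inter> ball x0 r = {x \<in> ball x0 r. Q x $ 2 > \<gamma> (Q x $ 1)})"

definition bounded_lipschitz_domain :: "(real^2) set \<Rightarrow> bool" where
  "bounded_lipschitz_domain \<Omega> \<longleftrightarrow>
     open \<Omega> \<and> connected \<Omega> \<and> \<Omega> \<noteq> {} \<and> bounded \<Omega> \<and> lipschitz_boundary \<Omega>"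

text \<open>The covering sets must be required to be bounded, since \<open>diameter\<close> is
  meaningful only on bounded sets. In dimension one the usual normalising constant is 1.\<close>

definition hausdorff1_delta :: "real \<Rightarrow> 'a::metric_space set \<Rightarrow> ennreal" where
  "hausdorff1_delta \<delta> A =
     (INF U \<in> {U :: nat \<Rightarrow> 'a set. A \<subseteq> (\<Union>i. U i) \<and> (\<forall>i. bounded (U i) \<and> diameter (U i) \<le> \<delta>)}.
        \<Sum>i. ennreal (diameter (U i)))"

definition hausdorff1 :: "'a::metric_space set \<Rightarrow> ennreal" where
  "hausdorff1 A = (SUP \<delta>\<in>{0<..}. hausdorff1_delta \<delta> A)"

text \<open>The grains are \<open>G 1, \<dots>, G K\<close>. The rotation field \<open>R\<close> is a total function,
  of which only the values on \<open>\<Omega>\<close> are constrained.\<close>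

definition polycrystal ::
  "(real^2) set \<Rightarrow> nat \<Rightarrow> (nat \<Rightarrow> (real^2) set) \<Rightarrow> (real^2 \<Rightarrow> real^2^2) \<Rightarrow> bool" where
  "polycrystal \<Omega> K G R \<longleftrightarrow>
     bounded_lipschitz_domain \<Omega> \<and>
     (\<forall>k\<in>{1..K}. bounded_lipschitz_domain (G k) \<and> G k \<subseteq> \<Omega>) \<and>
     disjoint_family_on G {1..K} \<and>
     negligible (\<Omega> - (\<Union>k\<in>{1..K}. G k)) \<and>
     \<Omega> = interior (\<Union>k\<in>{1..K}. closure (G k)) \<and>
     (\<forall>k\<in>{1..K}. interior (closure (G k)) = G k) \<and>
     (\<forall>x\<in>\<Omega>. rotation_matrix (R x)) \<and>
     (\<forall>k\<in>{1..K}. R constant_on G k) \<and>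
     (\<forall>k\<in>{1..K}. \<forall>l\<in>{1..K}. k \<noteq> l \<and> hausdorff1 (frontier (G k) \<inter> frontier (G l)) > 0 \<longrightarrow>
        (\<forall>x\<in>G k. \<forall>y\<in>G l. R x \<noteq> R y \<and> R x \<noteq> - R y))"

definition grain_values :: "nat \<Rightarrow> (nat \<Rightarrow> (real^2) set) \<Rightarrow> (real^2 \<Rightarrow> real^2^2) \<Rightarrow> (real^2^2) set" where
  "grain_values K G R = R ` (\<Union>k\<in>{1..K}. G k)"

definition \<N> :: "(real^2^2) set" where
  "\<N> = {F. det F = 1 \<and> norm (F *v axis 1 1) \<le> 1}"

definition right_mult :: "(real^2^2) set \<Rightarrow> real^2^2 \<Rightarrow> (real^2^2) set" where
  "right_mult M A = (\<lambda>F. F ** A) ` M"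

definition taylor_bound :: "(real^2^2) set \<Rightarrow> (real^2^2) set \<Rightarrow> (real^2^2) set" where
  "taylor_bound M S = (\<Inter>R\<in>S. right_mult M (transpose R))"

end

(* Let u_t = (cos t, sin t), so that F lies in N R_t^T iff det F = 1 and |F u_t| <= 1. If this
   holds at a and b with 0 <= b - a <= pi/2, then preservation of area forces the angle between
   F u_a and F u_b to be large: F u_a . F u_b <= u_a . u_b. Any u_t with a <= t <= b is a
   nonnegative combination of u_a and u_b, so expanding the square gives |F u_t| <= |u_t| = 1.
   This is applied to [0, theta_n] and to [theta_(n+1), pi], using that N R_pi^T = N. *)

theory Submission
  imports Defs
begin

definition unit_at :: "real \<Rightarrow> real^2" where
  "unit_at t = vector [cos t, sin t]"

lemma rot_mult_axis: "rot t *v axis 1 1 = unit_at t"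
  by (simp add: vec_eq_iff forall_2 rot_def unit_at_def matrix_vector_mult_def axis_def sum_2)

lemma det_rot: "det (rot t) = 1"
  by (simp add: det_2 rot_def flip: power2_eq_square)

lemma rot_mult_transpose: "rot t ** transpose (rot t) = mat 1" "transpose (rot t) ** rot t = mat 1"
  by (simp_all add: vec_eq_iff forall_2 rot_def matrix_matrix_mult_def transpose_def mat_def sum_2
      mult.commute flip: power2_eq_square)

lemma unit_at_pi: "unit_at pi = - unit_at 0"
  by (simp add: vec_eq_iff forall_2 unit_at_def)

lemma axis_eq_unit_at: "axis 1 1 = unit_at 0"
  by (simp add: vec_eq_iff forall_2 unit_at_def axis_def)

text \<open>Since \<open>rot t\<close> is inverse to its transpose, the only candidate for a
  preimage of F is \<open>F ** rot t\<close>. It has the determinant of F and sends the first axis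
  to F u_t, so membership becomes a condition on a single unit vector.\<close>

lemma mem_right_mult_rot_iff:
  "F \<in> right_mult \<N> (transpose (rot t)) \<longleftrightarrow> det F = 1 \<and> norm (F *v unit_at t) \<le> 1"
proof
  assume "F \<in> right_mult \<N> (transpose (rot t))"
  then obtain H where H: "det H = 1" "norm (H *v axis 1 1) \<le> 1" "F = H ** transpose (rot t)"
    by (auto simp: right_mult_def \<N>_def)
  have "F *v unit_at t = (F ** rot t) *v axis 1 1"
    by (simp flip: rot_mult_axis matrix_vector_mul_assoc)
  also have "F ** rot t = H"
    by (simp add: H(3) rot_mult_transpose flip: matrix_mul_assoc)
  finally show "det F = 1 \<and> norm (F *v unit_at t) \<le> 1"
    using H by (simp add: det_mul det_rot)
next
  assume F: "det F = 1 \<and> norm (F *v unit_at t) \<le> 1"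
  have "F = (F ** rot t) ** transpose (rot t)"
    by (simp add: rot_mult_transpose flip: matrix_mul_assoc)
  moreover have "F ** rot t \<in> \<N>"
    using F by (simp add: \<N>_def det_mul det_rot rot_mult_axis flip: matrix_vector_mul_assoc)
  ultimately show "F \<in> right_mult \<N> (transpose (rot t))"
    unfolding right_mult_def by blast
qed

lemma mem_\<N>_iff: "F \<in> \<N> \<longleftrightarrow> det F = 1 \<and> norm (F *v unit_at 0) \<le> 1"
  by (simp add: \<N>_def axis_eq_unit_at)

lemma norm_mult_unit_at_pi: "norm (F *v unit_at pi) = norm (F *v unit_at 0)"
  by (simp add: unit_at_pi linear_neg[OF matrix_vector_mul_linear])

text \<open>Lagrange's identity |x|^2 |y|^2 - (x . y)^2 = det[x, y]^2 at x = F u, y = F v, together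
  with det[F u, F v] = det F * det[u, v].\<close>

lemma gram_det_2:
  fixes F :: "real^2^2"
  shows "((F *v u) \<bullet> (F *v v))\<^sup>2 =
    (norm (F *v u))\<^sup>2 * (norm (F *v v))\<^sup>2 - (det F)\<^sup>2 * (u$1 * v$2 - u$2 * v$1)\<^sup>2"
  by (simp add: power2_norm_eq_inner inner_vec_def matrix_vector_mult_def sum_2 det_2)
     (simp add: algebra_simps power2_eq_square)

text \<open>Cramer's rule for u_t in terms of u_a and u_b, with the determinant sin (b - a)
  multiplied out to avoid a division.\<close>

lemma unit_at_combination:
  "sin (b - a) *\<^sub>R unit_at t = sin (b - t) *\<^sub>R unit_at a + sin (t - a) *\<^sub>R unit_at b"
proof -
  have "cos t * (sin b * cos a - cos b * sin a) =
      cos a * (sin b * cos t - cos b * sin t) + cos b * (sin t * cos a - cos t * sin a)"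
    "sin t * (sin b * cos a - cos b * sin a) =
      sin a * (sin b * cos t - cos b * sin t) + sin b * (sin t * cos a - cos t * sin a)"
    by (simp_all add: algebra_simps)
  then show ?thesis
    by (simp add: vec_eq_iff forall_2 unit_at_def sin_diff mult.commute)
qed

lemma inner_unit_at: "unit_at a \<bullet> unit_at b = cos (b - a)"
  by (simp add: inner_vec_def sum_2 unit_at_def cos_diff mult.commute)

lemma norm_mult_unit_at_le_1:
  assumes det: "det F = 1" and a: "norm (F *v unit_at a) \<le> 1" and b: "norm (F *v unit_at b) \<le> 1"
    and t: "a \<le> t" "t \<le> b" and ab: "b - a \<le> pi / 2"
  shows "norm (F *v unit_at t) \<le> 1"
\<comment> \<open>For a = b the factor S below vanishes and could not be cancelled at the
  end.\<close>
proof (cases "a = b")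
  case True
  with a t show ?thesis by simp
next
  case False
  define S where "S = sin (b - a)"
  define p where "p = sin (b - t)"
  define q where "q = sin (t - a)"
  have S: "S > 0"
    unfolding S_def using False t ab pi_gt_zero by (intro sin_gt_zero) linarith+
  have pq: "p \<ge> 0" "q \<ge> 0"
    unfolding p_def q_def using t ab pi_gt_zero by (auto intro!: sin_ge_zero)
  \<comment> \<open>This is where pi / 2 is essential: the squared inequality obtained below yields
    an upper bound by cos (b - a) itself only if that cosine is nonnegative.\<close>
  have c: "cos (b - a) \<ge> 0"
    using t ab pi_gt_zero by (intro cos_ge_zero) linarith+
  have na: "(norm (F *v unit_at a))\<^sup>2 \<le> 1" and nb: "(norm (F *v unit_at b))\<^sup>2 \<le> 1"
    using a b by (simp_all add: power_le_one)
  have "unit_at a $ 1 * unit_at b $ 2 - unit_at a $ 2 * unit_at b $ 1 = S"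
    by (simp add: unit_at_def S_def sin_diff mult.commute)
  then have "((F *v unit_at a) \<bullet> (F *v unit_at b))\<^sup>2 =
      (norm (F *v unit_at a))\<^sup>2 * (norm (F *v unit_at b))\<^sup>2 - S\<^sup>2"
    using det by (simp add: gram_det_2)
  also have "\<dots> \<le> 1 - S\<^sup>2"
    using mult_le_one[OF na _ nb] by simp
  also have "\<dots> = (cos (b - a))\<^sup>2"
    by (simp add: S_def cos_squared_eq)
  finally have inner: "(F *v unit_at a) \<bullet> (F *v unit_at b) \<le> unit_at a \<bullet> unit_at b"
    unfolding inner_unit_at using c by (rule power2_le_imp_le)
  have expand: "(norm (p *\<^sub>R x + q *\<^sub>R y))\<^sup>2 = p\<^sup>2 * (norm x)\<^sup>2 + q\<^sup>2 * (norm y)\<^sup>2 + 2 * (p * q) * (x \<bullet> y)"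
    for x y :: "real^2"
    unfolding power2_norm_eq_inner inner_add_left inner_add_right
    by (simp add: inner_commute[of y x] power2_eq_square algebra_simps)
  have comb: "S *\<^sub>R unit_at t = p *\<^sub>R unit_at a + q *\<^sub>R unit_at b"
    unfolding S_def p_def q_def by (rule unit_at_combination)
  have norm1: "norm (unit_at s) = 1" for s
    by (simp add: norm_eq_sqrt_inner inner_unit_at)
  have "S *\<^sub>R (F *v unit_at t) = p *\<^sub>R (F *v unit_at a) + q *\<^sub>R (F *v unit_at b)"
    using arg_cong[OF comb, of "(*v) F"]
    by (simp add: matrix_vector_right_distrib matrix_vector_mult_scaleR)
  then have "(S * norm (F *v unit_at t))\<^sup>2 = (norm (p *\<^sub>R (F *v unit_at a) + q *\<^sub>R (F *v unit_at b)))\<^sup>2"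
    using S by (metis abs_of_pos norm_scaleR)
  \<comment> \<open>The bound is the same quadratic expression with F replaced by the identity, so
    \<open>comb\<close> evaluates it to S^2. The sign of p * q lets the one-sided estimate
    \<open>inner\<close> suffice.\<close>
  also have "\<dots> \<le> p\<^sup>2 * 1 + q\<^sup>2 * 1 + 2 * (p * q) * (unit_at a \<bullet> unit_at b)"
    unfolding expand using pq na nb inner by (intro add_mono mult_left_mono) auto
  also have "\<dots> = (norm (S *\<^sub>R unit_at t))\<^sup>2"
    unfolding comb expand by (simp add: norm1)
  also have "\<dots> = S\<^sup>2"
    by (simp add: norm1)
  finally have "S * norm (F *v unit_at t) \<le> S"
    using less_imp_le[OF S] by (rule power2_le_imp_le)
  then show ?thesis
    using S by simp
qed

text \<open>The index is the last one with value below c. If it is N, the successor is covered by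
  \<open>hi\<close>, as monotonicity is assumed only on {1..N}.\<close>

lemma ex1_crossing_index:
  fixes \<theta> :: "nat \<Rightarrow> 'a::linorder"
  assumes mono: "strict_mono_on {1..N} \<theta>" and N: "N \<ge> 1" and lo: "\<theta> 1 < c" and hi: "c \<le> \<theta> (N + 1)"
  shows "\<exists>!n. n \<in> {1..N} \<and> \<theta> n < c \<and> c \<le> \<theta> (n + 1)"
proof (rule ex_ex1I)
  define A where "A = {i \<in> {1..N}. \<theta> i < c}"
  have A: "finite A" "A \<noteq> {}"
    using N lo by (auto simp: A_def)
  then have "Max A \<in> A" by (rule Max_in)
  moreover have "c \<le> \<theta> (Max A + 1)"
  proof (cases "Max A = N")
    case False
    have "Max A + 1 \<notin> A"
      using Max_ge[OF A(1), of "Max A + 1"] by auto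
    then show ?thesis
      using False \<open>Max A \<in> A\<close> by (auto simp: A_def)
  qed (use hi in simp)
  ultimately show "\<exists>n. n \<in> {1..N} \<and> \<theta> n < c \<and> c \<le> \<theta> (n + 1)"
    by (auto simp: A_def)
next
  have False if "m \<in> {1..N}" "n \<in> {1..N}" "m < n" "c \<le> \<theta> (m + 1)" "\<theta> n < c" for m n
    \<comment> \<open>From m < n follows m + 1 \<le> n \<le> N, so c \<le> \<theta> (m + 1) \<le>
      \<theta> n < c.\<close>
    using strict_mono_on_leD[OF mono, of "m + 1" n] that by auto
  then show "m = n" if "m \<in> {1..N} \<and> \<theta> m < c \<and> c \<le> \<theta> (m + 1)"
    "n \<in> {1..N} \<and> \<theta> n < c \<and> c \<le> \<theta> (n + 1)" for m n
    using that by (metis linorder_neqE_nat)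
qed

theorem proposition1p1:
  fixes \<Omega> :: "(real^2) set" and K :: nat and G :: "nat \<Rightarrow> (real^2) set"
    and R :: "real^2 \<Rightarrow> real^2^2" and N :: nat and \<theta> :: "nat \<Rightarrow> real"
  assumes "polycrystal \<Omega> K G R"
    and "N \<ge> 2"
    and "grain_values K G R = (\<lambda>i. rot (\<theta> i)) ` {1..N}"
    and "\<theta> 1 = 0" and "strict_mono_on {1..N} \<theta>" and "\<theta> N < pi"
    and "\<theta> (N + 1) = pi"
  shows "(\<exists>!n. n \<in> {1..N} \<and> \<theta> n < pi / 2 \<and> pi / 2 \<le> \<theta> (n + 1)) \<and>
    (\<forall>n\<in>{1..N}. \<theta> n < pi / 2 \<and> pi / 2 \<le> \<theta> (n + 1) \<longrightarrow>
       taylor_bound \<N> (grain_values K G R) =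
         \<N> \<inter> right_mult \<N> (transpose (rot (\<theta> n))) \<inter> right_mult \<N> (transpose (rot (\<theta> (n + 1)))))"
proof (intro conjI ballI impI)
  show "\<exists>!n. n \<in> {1..N} \<and> \<theta> n < pi / 2 \<and> pi / 2 \<le> \<theta> (n + 1)"
    using assms by (intro ex1_crossing_index) auto
next
  fix n assume n: "n \<in> {1..N}" and bounds: "\<theta> n < pi / 2 \<and> pi / 2 \<le> \<theta> (n + 1)"
  have le: "\<theta> i \<le> \<theta> j" if "i \<in> {1..N}" "j \<in> {1..N}" "i \<le> j" for i j
    using strict_mono_on_leD[OF assms(5)] that by blast
  have taylor: "taylor_bound \<N> (grain_values K G R) =
      {F. det F = 1 \<and> (\<forall>i\<in>{1..N}. norm (F *v unit_at (\<theta> i)) \<le> 1)}"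
    \<comment> \<open>Nonemptiness of {1..N} is what allows det F = 1 to be pulled out of the
      intersection.\<close>
    using \<open>N \<ge> 2\<close> by (auto simp: taylor_bound_def assms(3) mem_right_mult_rot_iff ball_conj_distrib)
  have succ: "norm (F *v unit_at (\<theta> (n + 1))) \<le> 1" if "\<forall>i\<in>{1..N}. norm (F *v unit_at (\<theta> i)) \<le> 1"
    for F :: "real^2^2"
  \<comment> \<open>For n = N the angle \<theta> (n + 1) = pi is not a grain value; its bound is the
    one at \<theta> 1 = 0, because u_pi = -u_0.\<close>
  proof (cases "n = N")
    case True
    then show ?thesis
      using that[rule_format, of 1] \<open>N \<ge> 2\<close> assms(4,7) by (simp add: norm_mult_unit_at_pi)
  qed (use that n in auto)
  have all: "norm (F *v unit_at (\<theta> i)) \<le> 1"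
    if F: "det F = 1" "norm (F *v unit_at 0) \<le> 1" "norm (F *v unit_at (\<theta> n)) \<le> 1"
      "norm (F *v unit_at (\<theta> (n + 1))) \<le> 1" and i: "i \<in> {1..N}"
    for F i
  \<comment> \<open>No angle lies strictly between \<theta> n and \<theta> (n + 1), so each falls
    into [0, \<theta> n] or [\<theta> (n + 1), pi], both of length at most pi / 2. The second case
    forces n < N, so n + 1 is again in the range of monotonicity.\<close>
  proof (cases "i \<le> n")
    case True
    then have "0 \<le> \<theta> i" "\<theta> i \<le> \<theta> n"
      using i n le[of 1 i] le[of i n] assms(4) by auto
    moreover have "\<theta> n - 0 \<le> pi / 2"
      using bounds by linarith
    ultimately show ?thesis
      using norm_mult_unit_at_le_1[OF F(1-3)] by blast
  next
    case False
    then have "\<theta> (n + 1) \<le> \<theta> i"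
      using i n by (intro le) auto
    moreover have "\<theta> i \<le> pi"
      using i le[of i N] assms(6) by auto
    moreover have "pi - \<theta> (n + 1) \<le> pi / 2"
      using bounds by linarith
    moreover have "norm (F *v unit_at pi) \<le> 1"
      using F(2) by (simp only: norm_mult_unit_at_pi)
    ultimately show ?thesis
      using norm_mult_unit_at_le_1[OF F(1) F(4)] by blast
  qed
  have first: "norm (F *v unit_at 0) \<le> 1" if "\<forall>i\<in>{1..N}. norm (F *v unit_at (\<theta> i)) \<le> 1"
    for F :: "real^2^2"
    using that[rule_format, of 1] \<open>N \<ge> 2\<close> assms(4) by simp
  show "taylor_bound \<N> (grain_values K G R) =
      \<N> \<inter> right_mult \<N> (transpose (rot (\<theta> n))) \<inter> right_mult \<N> (transpose (rot (\<theta> (n + 1))))"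
    unfolding taylor set_eq_iff Int_iff mem_right_mult_rot_iff mem_\<N>_iff mem_Collect_eq
    using n succ first all by blast
qed

end
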